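(* Let $A$ be a $B_1$-algebra. The topological spaces $Pr_s(A)$ and $MaxSpec(A)$ are $T_0$ and quasi-compact.
   Context: A (commutative) $B_1$-algebra is a commutative semiring $A$ with $0$ (absorbing for multiplication) and $1$, in which $1+1=1$ (so $x+x=x$ for all $x\in A$). An ideal of $A$ is a subset containing $0$, stable under addition and under multiplication by elements of $A$. An ideal $\mathcal P$ is prime if $\mathcal P\neq A$ and $ab\in\mathcal P$ implies $a\in\mathcal P$ or $b\in\mathcal P$. A congruence on $A$ is an equivalence relation compatible with addition and multiplication; the trivial congruence is the one under which any two elements are equivalent. Congruences are ordered by inclusion. For a congruence $\mathcal R$, $I(\mathcal R):=\{x\in A\mid x\,\mathcal R\,0\}$, an ideal. An ideal $J$ is saturated if $J=I(\mathcal R)$ for some congruence $\mathcal R$. A nontrivial congruence $\mathcal R$ is prime if $ab\,\mathcal R\,0$ implies $a\,\mathcal R\,0$ or $b\,\mathcal R\,0$. $Spec(A)$ is the set of prime congruences; $MaxSpec(A)\subseteq Spec(A)$ is the set of maximal elements among nontrivial congruences; $Pr(A)$ is the set of prime ideals and $Pr_s(A)$ the set of saturated prime ideals. The closed sets of $Pr(A)$ are the sets $W(S):=\{\mathcal P\in Pr(A)\mid S\subseteq\mathcal P\}$, $S\subseteq A$; the closed sets of $Spec(A)$ are the sets $V(S):=\{\mathcal R\in Spec(A)\mid S\subseteq I(\mathcal R)\}$, $S\subseteq A$. $Pr_s(A)$ and $MaxSpec(A)$ carry the induced topologies. Quasi-compact means every open cover has a finite subcover (no separation assumed). *)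

theory Defs
  imports "HOL-Analysis.Analysis"
begin

(* Not based on comm_semiring_1, whose axiom 0 ~= 1 would exclude the zero algebra. *)
class b1_algebra = comm_semiring_0 + comm_monoid_mult +
  assumes one_plus_one: "1 + 1 = 1"

definition ideal :: "'a::b1_algebra set \<Rightarrow> bool" where
  "ideal J \<longleftrightarrow> 0 \<in> J \<and> (\<forall>x\<in>J. \<forall>y\<in>J. x + y \<in> J) \<and> (\<forall>a. \<forall>x\<in>J. a * x \<in> J)"

definition prime_ideal :: "'a::b1_algebra set \<Rightarrow> bool" where
  "prime_ideal P \<longleftrightarrow> ideal P \<and> P \<noteq> UNIV \<and> (\<forall>a b. a * b \<in> P \<longrightarrow> a \<in> P \<or> b \<in> P)"

definition congruence :: "('a::b1_algebra) rel \<Rightarrow> bool" where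
  "congruence R \<longleftrightarrow> equiv UNIV R \<and>
     (\<forall>x x' y y'. (x, x') \<in> R \<longrightarrow> (y, y') \<in> R \<longrightarrow> (x + y, x' + y') \<in> R \<and> (x * y, x' * y') \<in> R)"

definition nontrivial_congruence :: "('a::b1_algebra) rel \<Rightarrow> bool" where
  "nontrivial_congruence R \<longleftrightarrow> congruence R \<and> R \<noteq> UNIV"

definition ideal_of :: "('a::b1_algebra) rel \<Rightarrow> 'a set" where
  "ideal_of R = {x. (x, 0) \<in> R}"

definition saturated :: "'a::b1_algebra set \<Rightarrow> bool" where
  "saturated J \<longleftrightarrow> ideal J \<and> (\<exists>R. congruence R \<and> J = ideal_of R)"

definition prime_congruence :: "('a::b1_algebra) rel \<Rightarrow> bool" where
  "prime_congruence R \<longleftrightarrow> nontrivial_congruence R \<and>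
     (\<forall>a b. (a * b, 0) \<in> R \<longrightarrow> (a, 0) \<in> R \<or> (b, 0) \<in> R)"

definition Spec :: "('a::b1_algebra) rel set" where
  "Spec = {R. prime_congruence R}"

definition MaxSpec :: "('a::b1_algebra) rel set" where
  "MaxSpec = {R. nontrivial_congruence R \<and>
     (\<forall>R'. nontrivial_congruence R' \<longrightarrow> R \<subseteq> R' \<longrightarrow> R' = R)}"

definition Pr :: "'a::b1_algebra set set" where
  "Pr = {P. prime_ideal P}"

definition Pr_s :: "'a::b1_algebra set set" where
  "Pr_s = {P. prime_ideal P \<and> saturated P}"

definition W :: "'a::b1_algebra set \<Rightarrow> 'a set set" where
  "W S = {P \<in> Pr. S \<subseteq> P}"

definition V :: "'a::b1_algebra set \<Rightarrow> 'a rel set" where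
  "V S = {R \<in> Spec. S \<subseteq> ideal_of R}"

definition Pr_topology :: "'a::b1_algebra set topology" where
  "Pr_topology = topology (\<lambda>U. \<exists>S. U = Pr - W S)"

definition Spec_topology :: "('a::b1_algebra) rel topology" where
  "Spec_topology = topology (\<lambda>U. \<exists>S. U = Spec - V S)"

definition Pr_s_topology :: "'a::b1_algebra set topology" where
  "Pr_s_topology = subtopology Pr_topology Pr_s"

definition MaxSpec_topology :: "('a::b1_algebra) rel topology" where
  "MaxSpec_topology = subtopology Spec_topology MaxSpec"


lemma ideal_of_congruence:
  assumes "congruence R"
  shows "ideal (ideal_of R)"
proof -
  have r: "(x, x) \<in> R" for x
    using assms by (auto simp: congruence_def equiv_def refl_on_def)
  have "(x + y, 0) \<in> R" if "(x, 0) \<in> R" "(y, 0) \<in> R" for x y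
    using assms that unfolding congruence_def by (metis add_0)
  moreover have "(a * x, 0) \<in> R" if "(x, 0) \<in> R" for a x
    using assms that r unfolding congruence_def by (metis mult_zero_right)
  ultimately show ?thesis
    using r by (auto simp: ideal_def ideal_of_def)
qed

(* Both topologies have this form, the points x of X being tested on the ideals f x. *)
lemma istopology_ideals:
  fixes f :: "'b \<Rightarrow> 'a::b1_algebra set"
  assumes f: "\<And>x. x \<in> X \<Longrightarrow> prime_ideal (f x)"
  shows "istopology (\<lambda>U. \<exists>S. U = X - {x \<in> X. S \<subseteq> f x})"
  unfolding istopology_def
proof (intro conjI allI impI)
  fix U U' :: "'b set"
  assume "\<exists>S. U = X - {x \<in> X. S \<subseteq> f x}" "\<exists>S. U' = X - {x \<in> X. S \<subseteq> f x}"
  then obtain S T where U: "U = X - {x \<in> X. S \<subseteq> f x}" "U' = X - {x \<in> X. T \<subseteq> f x}"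
    by blast
  have *: "{s * t |s t. s \<in> S \<and> t \<in> T} \<subseteq> f x \<longleftrightarrow> S \<subseteq> f x \<or> T \<subseteq> f x" if "x \<in> X" for x
  proof
    assume "{s * t |s t. s \<in> S \<and> t \<in> T} \<subseteq> f x"
    then show "S \<subseteq> f x \<or> T \<subseteq> f x"
      using f[OF that] unfolding prime_ideal_def by blast
  next
    have i: "a * y \<in> f x" "y * a \<in> f x" if "y \<in> f x" for a y
      using f[OF \<open>x \<in> X\<close>] that by (auto simp: prime_ideal_def ideal_def mult.commute)
    assume "S \<subseteq> f x \<or> T \<subseteq> f x"
    then show "{s * t |s t. s \<in> S \<and> t \<in> T} \<subseteq> f x"
      using i by blast
  qed
  have "U \<inter> U' = X - {x \<in> X. {s * t |s t. s \<in> S \<and> t \<in> T} \<subseteq> f x}"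
    unfolding U by (rule set_eqI) (use * in \<open>simp; blast\<close>)
  then show "\<exists>S. U \<inter> U' = X - {x \<in> X. S \<subseteq> f x}" by blast
next
  fix K :: "'b set set"
  assume "\<forall>U\<in>K. \<exists>S. U = X - {x \<in> X. S \<subseteq> f x}"
  then obtain g where g: "\<And>U. U \<in> K \<Longrightarrow> U = X - {x \<in> X. g U \<subseteq> f x}"
    by metis
  have "\<Union>K = (\<Union>U\<in>K. X - {x \<in> X. g U \<subseteq> f x})"
    using g by auto
  also have "\<dots> = X - {x \<in> X. \<Union>(g ` K) \<subseteq> f x}"
    by auto
  finally show "\<exists>S. \<Union>K = X - {x \<in> X. S \<subseteq> f x}" by blast
qed

lemma prime_ideal_of_congruence:
  assumes "prime_congruence R"
  shows "prime_ideal (ideal_of R)"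
proof -
  have R: "congruence R" "R \<noteq> UNIV"
    using assms by (auto simp: prime_congruence_def nontrivial_congruence_def)
  have "(x, y) \<in> R" if "ideal_of R = UNIV" for x y
  proof -
    have "(x, 0) \<in> R" "(y, 0) \<in> R"
      using that unfolding ideal_of_def by auto
    then show ?thesis
      using R(1) unfolding congruence_def equiv_def by (meson symD transD)
  qed
  then have "ideal_of R \<noteq> UNIV" using R(2) by auto
  then show ?thesis
    using assms ideal_of_congruence[OF R(1)]
    by (auto simp: prime_ideal_def prime_congruence_def ideal_of_def)
qed

lemma openin_Pr_topology: "openin Pr_topology (U :: 'a::b1_algebra set set) \<longleftrightarrow> (\<exists>S. U = Pr - W S)"
proof -
  have "istopology (\<lambda>U. \<exists>S. U = Pr - W (S :: 'a set))"
    unfolding W_def by (rule istopology_ideals) (simp add: Pr_def)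
  then show ?thesis by (simp add: Pr_topology_def)
qed

lemma openin_Spec_topology: "openin Spec_topology (U :: ('a::b1_algebra) rel set) \<longleftrightarrow> (\<exists>S. U = Spec - V S)"
proof -
  have "istopology (\<lambda>U. \<exists>S. U = Spec - V (S :: 'a set))"
    unfolding V_def by (rule istopology_ideals) (simp add: Spec_def prime_ideal_of_congruence)
  then show ?thesis by (simp add: Spec_topology_def)
qed

lemma topspace_Pr_topology: "topspace Pr_topology = (Pr :: 'a::b1_algebra set set)"
proof -
  have "Pr = Pr - W (UNIV :: 'a set)"
    by (auto simp: W_def Pr_def prime_ideal_def)
  then have "openin Pr_topology (Pr :: 'a set set)"
    using openin_Pr_topology by blast
  then show ?thesis
    unfolding topspace_def openin_Pr_topology by blast
qed

lemma topspace_Spec_topology: "topspace Spec_topology = (Spec :: ('a::b1_algebra) rel set)"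
proof -
  have "V (UNIV :: 'a set) = {}"
    using prime_ideal_of_congruence by (auto simp: V_def Spec_def prime_ideal_def)
  then have "openin Spec_topology (Spec :: 'a rel set)"
    unfolding openin_Spec_topology by (metis Diff_empty)
  then show ?thesis
    unfolding topspace_def openin_Spec_topology by blast
qed

lemma closedin_Pr_topology: "closedin Pr_topology (C :: 'a::b1_algebra set set) \<longleftrightarrow> (\<exists>S. C = W S)"
proof -
  have "W S \<subseteq> Pr" for S :: "'a set"
    by (auto simp: W_def)
  then show ?thesis
    unfolding closedin_def topspace_Pr_topology openin_Pr_topology
    by (metis Diff_Diff_Int Int_absorb1)
qed

lemma closedin_Spec_topology: "closedin Spec_topology (C :: ('a::b1_algebra) rel set) \<longleftrightarrow> (\<exists>S. C = V S)"
proof -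
  have "V S \<subseteq> Spec" for S :: "'a set"
    by (auto simp: V_def)
  then show ?thesis
    unfolding closedin_def topspace_Spec_topology openin_Spec_topology
    by (metis Diff_Diff_Int Int_absorb1)
qed

lemma MaxSpec_subset_Spec: "MaxSpec \<subseteq> (Spec :: ('a::b1_algebra) rel set)"
proof
  fix R :: "'a rel"
  assume "R \<in> MaxSpec"
  then have nt: "nontrivial_congruence R"
    and max: "\<And>R'. nontrivial_congruence R' \<Longrightarrow> R \<subseteq> R' \<Longrightarrow> R' = R"
    by (auto simp: MaxSpec_def)
  have c: "congruence R" using nt by (simp add: nontrivial_congruence_def)
  have r: "(x, x) \<in> R" for x
    using c by (auto simp: congruence_def equiv_def refl_on_def)
  have s: "(y, x) \<in> R" if "(x, y) \<in> R" for x y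
    using c that by (auto simp: congruence_def equiv_def dest: symD)
  have t: "(x, z) \<in> R" if "(x, y) \<in> R" "(y, z) \<in> R" for x y z
    using c that by (auto simp: congruence_def equiv_def dest: transD)
  have p: "(x + y, x' + y') \<in> R" "(x * y, x' * y') \<in> R"
    if "(x, x') \<in> R" "(y, y') \<in> R" for x x' y y'
    using c that by (auto simp: congruence_def)
  have "(b, 0) \<in> R" if ab: "(a * b, 0) \<in> R" and a: "(a, 0) \<notin> R" for a b
  proof -
    define Q where "Q = {(x, y). (a * x, a * y) \<in> R}"
    have mult: "(a * (x * y), a * (x' * y')) \<in> R"
      if "(a * x, a * x') \<in> R" "(a * y, a * y') \<in> R" for x x' y y'
    proof (rule t)
      show "(a * (x * y), a * (x' * y)) \<in> R"
        using p(2)[OF that(1) r[of y]] by (simp add: mult.assoc)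
      show "(a * (x' * y), a * (x' * y')) \<in> R"
        using p(2)[OF r[of x'] that(2)] by (simp add: mult.left_commute)
    qed
    have "equiv UNIV Q"
      by (auto simp: Q_def equiv_def refl_on_def sym_def trans_def intro: r s t)
    moreover have "(x + y, x' + y') \<in> Q \<and> (x * y, x' * y') \<in> Q"
      if "(x, x') \<in> Q" "(y, y') \<in> Q" for x x' y y'
      using that p(1)[of "a * x" "a * x'" "a * y" "a * y'"] mult[of x x' y y']
      by (simp add: Q_def distrib_left)
    ultimately have "congruence Q"
      unfolding congruence_def by blast
    moreover have "(1, 0) \<notin> Q" using a by (simp add: Q_def)
    ultimately have "nontrivial_congruence Q"
      by (auto simp: nontrivial_congruence_def)
    moreover have "R \<subseteq> Q" by (auto simp: Q_def intro: p r)
    ultimately have "Q = R" by (rule max)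
    moreover have "(b, 0) \<in> Q" using ab by (simp add: Q_def)
    ultimately show ?thesis by simp
  qed
  then show "R \<in> Spec" using nt by (auto simp: Spec_def prime_congruence_def)
qed

end

(* Saturated ideals are the ideals that are downward closed for the order x <= y iff x + y = y.
   A saturated prime ideal P is the class of 0 of the congruence R_P with the two classes P and
   A - P, and R_P contains every congruence whose class of 0 is P. So a maximal congruence is
   determined by its class of 0, which gives T_0, and R_P is maximal when P is maximal among the
   proper saturated ideals; such a P is always prime. For quasi-compactness, suppose that every
   finite subset of S lies in a proper saturated ideal. As the saturated ideal generated by S is
   the directed union of those generated by the finite subsets of S, it omits 1, and by Zorn's
   lemma it lies in a maximal one. *)
theory Submission
  imports Defs
begin

section \<open>Saturated ideals\<close>

text \<open>An elementwise substitute for \<open>saturated\<close>: with no congruence to exhibit,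
  it passes easily to unions of chains and to ideal quotients.\<close>

definition lower_ideal :: "'a::b1_algebra set \<Rightarrow> bool" where
  "lower_ideal J \<longleftrightarrow> ideal J \<and> (\<forall>x. \<forall>y\<in>J. x + y = y \<longrightarrow> x \<in> J)"

lemma add_idem: "x + x = (x::'a::b1_algebra)"
  by (metis distrib_left mult_1_right one_plus_one)

lemma lower_idealI:
  assumes "0 \<in> J" "\<And>x y. x \<in> J \<Longrightarrow> y \<in> J \<Longrightarrow> x + y \<in> J" "\<And>a x. x \<in> J \<Longrightarrow> a * x \<in> J"
    "\<And>x y. y \<in> J \<Longrightarrow> x + y = y \<Longrightarrow> x \<in> J"
  shows "lower_ideal J"
  using assms by (auto simp: lower_ideal_def ideal_def)

lemma lower_idealD:
  assumes "lower_ideal J"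
  shows "0 \<in> J" "\<And>x y. x \<in> J \<Longrightarrow> y \<in> J \<Longrightarrow> x + y \<in> J" "\<And>a x. x \<in> J \<Longrightarrow> a * x \<in> J"
    "\<And>x y. y \<in> J \<Longrightarrow> x + y = y \<Longrightarrow> x \<in> J"
  using assms unfolding lower_ideal_def ideal_def by blast+

lemma lower_ideal_eq_UNIV_iff:
  assumes "lower_ideal J"
  shows "J = UNIV \<longleftrightarrow> 1 \<in> J"
  using lower_idealD(3)[OF assms, of 1] by auto

text \<open>By idempotence both summands lie below \<open>x + y\<close>, so downward closure gives
  the forward direction.\<close>

lemma lower_ideal_add_iff:
  assumes "lower_ideal J"
  shows "x + y \<in> J \<longleftrightarrow> x \<in> J \<and> y \<in> J"
proof -
  have "x + (x + y) = x + y" "y + (x + y) = x + y"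
    by (metis add.assoc add_idem, metis add.left_commute add_idem)
  then show ?thesis
    using lower_idealD(2,4)[OF assms] by blast
qed

lemma congruenceD:
  assumes "congruence R"
  shows "(x, x) \<in> R" "(x, y) \<in> R \<Longrightarrow> (y, x) \<in> R" "(x, y) \<in> R \<Longrightarrow> (y, z) \<in> R \<Longrightarrow> (x, z) \<in> R"
    "(x, x') \<in> R \<Longrightarrow> (y, y') \<in> R \<Longrightarrow> (x + y, x' + y') \<in> R"
proof -
  have "refl R" "sym R" "trans R"
    using assms by (auto simp: congruence_def equiv_def)
  then show "(x, x) \<in> R" "(x, y) \<in> R \<Longrightarrow> (y, x) \<in> R" "(x, y) \<in> R \<Longrightarrow> (y, z) \<in> R \<Longrightarrow> (x, z) \<in> R"
    by (auto intro: reflD symD transD)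
  show "(x, x') \<in> R \<Longrightarrow> (y, y') \<in> R \<Longrightarrow> (x + y, x' + y') \<in> R"
    using assms unfolding congruence_def by blast
qed

text \<open>If \<open>y\<close> is congruent to 0 and \<open>x + y = y\<close>, adding
  \<open>x\<close> makes \<open>y\<close> congruent to \<open>x\<close>, so \<open>x\<close> is
  congruent to 0.\<close>

lemma lower_ideal_ideal_of:
  assumes "congruence R"
  shows "lower_ideal (ideal_of R)"
proof -
  have "(x, 0) \<in> R" if "(y, 0) \<in> R" "x + y = y" for x y
  proof -
    have "(y, x) \<in> R"
      using congruenceD(4)[OF assms congruenceD(1)[OF assms, of x] that(1)] that(2) by simp
    then show ?thesis
      using congruenceD(2,3)[OF assms] that(1) by blast
  qed
  then show ?thesis
    using ideal_of_congruence[OF assms] by (auto simp: lower_ideal_def ideal_of_def)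
qed

section \<open>Existence and primality of maximal proper lower ideals\<close>

lemma lower_ideal_Union_chain:
  assumes "\<C> \<noteq> {}" "\<And>J. J \<in> \<C> \<Longrightarrow> lower_ideal J" "subset.chain \<A> \<C>"
  shows "lower_ideal (\<Union>\<C>)"
proof (rule lower_idealI)
  fix x y
  assume "x \<in> \<Union>\<C>" "y \<in> \<Union>\<C>"
  then obtain J K where "x \<in> J" "J \<in> \<C>" "y \<in> K" "K \<in> \<C>" by blast
  moreover have "J \<subseteq> K \<or> K \<subseteq> J"
    using assms(3) calculation unfolding subset_chain_def by blast
  ultimately show "x + y \<in> \<Union>\<C>"
    using lower_idealD(2)[OF assms(2)] by blast
next
  show "0 \<in> \<Union>\<C>"
    using assms(1) lower_idealD(1)[OF assms(2)] by blast
next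
  fix a x
  assume "x \<in> \<Union>\<C>"
  then show "a * x \<in> \<Union>\<C>"
    using lower_idealD(3)[OF assms(2)] by blast
next
  fix x y
  assume "y \<in> \<Union>\<C>" "x + y = y"
  then show "x \<in> \<Union>\<C>"
    using lower_idealD(4)[OF assms(2)] by blast
qed

text \<open>Properness, in the form \<open>1 \<notin> K\<close>, survives unions of chains, so
  Zorn's lemma applies above \<open>J\<close>. Maximality then holds among all proper lower ideals,
  since any \<open>K\<close> above \<open>M\<close> contains \<open>J\<close>.\<close>

lemma lower_ideal_subset_maximal:
  assumes "lower_ideal J" "1 \<notin> J"
  obtains M where "lower_ideal M" "1 \<notin> M" "J \<subseteq> M"
    "\<And>K. lower_ideal K \<Longrightarrow> 1 \<notin> K \<Longrightarrow> M \<subseteq> K \<Longrightarrow> K = M"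
proof -
  define \<A> where "\<A> = {K. lower_ideal K \<and> 1 \<notin> K \<and> J \<subseteq> K}"
  have "\<Union>\<C> \<in> \<A>" if "\<C> \<noteq> {}" "subset.chain \<A> \<C>" for \<C>
  proof -
    have "\<C> \<subseteq> \<A>" using that(2) by (simp add: subset_chain_def)
    then show ?thesis
      using that lower_ideal_Union_chain[of \<C> \<A>] by (auto simp: \<A>_def)
  qed
  moreover have "\<A> \<noteq> {}" using assms by (auto simp: \<A>_def)
  ultimately obtain M where "M \<in> \<A>" "\<And>K. K \<in> \<A> \<Longrightarrow> M \<subseteq> K \<Longrightarrow> K = M"
    using subset_Zorn_nonempty[of \<A>] by metis
  then show ?thesis
    by (intro that[of M]) (auto simp: \<A>_def)
qed

lemma prime_ideal_maximal:
  assumes M: "lower_ideal M" "1 \<notin> M"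
    and max: "\<And>K. lower_ideal K \<Longrightarrow> 1 \<notin> K \<Longrightarrow> M \<subseteq> K \<Longrightarrow> K = M"
  shows "prime_ideal M"
proof -
  note D = lower_idealD[OF M(1)]
  have "b \<in> M" if "a * b \<in> M" "a \<notin> M" for a b
  proof -
    \<comment> \<open>The ideal quotient of \<open>M\<close> by \<open>a\<close>: it contains
      \<open>M\<close> and is proper because \<open>a \<notin> M\<close>, so maximality forces it to
      be \<open>M\<close>.\<close>
    let ?K = "{x. a * x \<in> M}"
    have "lower_ideal ?K"
    proof (rule lower_idealI)
      fix x y
      assume "y \<in> ?K" "x + y = y"
      then show "x \<in> ?K"
        using D(4)[of "a * y" "a * x"] by (simp flip: distrib_left)
    qed (auto simp: D distrib_left mult.left_commute)
    moreover have "1 \<notin> ?K" "M \<subseteq> ?K"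
      using that(2) D(3) by auto
    ultimately have "?K = M" by (rule max)
    then show ?thesis using that(1) by blast
  qed
  then show ?thesis
    using M unfolding prime_ideal_def lower_ideal_def by blast
qed

text \<open>Membership of \<open>x\<close> in the saturated ideal generated by \<open>F\<close> is expressed through all saturated
  ideals containing \<open>F\<close>, which avoids linear combinations.\<close>

lemma lower_ideal_finite_character:
  assumes "\<And>F. finite F \<Longrightarrow> F \<subseteq> S \<Longrightarrow> \<exists>K. lower_ideal K \<and> 1 \<notin> K \<and> F \<subseteq> K"
  obtains J where "lower_ideal J" "1 \<notin> J" "S \<subseteq> J"
proof
  define J where
    "J = {x. \<exists>F. finite F \<and> F \<subseteq> S \<and> (\<forall>K. lower_ideal K \<longrightarrow> F \<subseteq> K \<longrightarrow> x \<in> K)}"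
  have J: "x \<in> J \<longleftrightarrow> (\<exists>F. finite F \<and> F \<subseteq> S \<and> (\<forall>K. lower_ideal K \<longrightarrow> F \<subseteq> K \<longrightarrow> x \<in> K))" for x
    by (simp add: J_def)
  show "lower_ideal J"
  proof (rule lower_idealI)
    show "0 \<in> J"
      unfolding J by (rule exI[of _ "{}"]) (simp add: lower_idealD(1))
  next
    fix x y
    assume "x \<in> J" "y \<in> J"
    then obtain F G where "finite F" "F \<subseteq> S" "\<And>K. lower_ideal K \<Longrightarrow> F \<subseteq> K \<Longrightarrow> x \<in> K"
      "finite G" "G \<subseteq> S" "\<And>K. lower_ideal K \<Longrightarrow> G \<subseteq> K \<Longrightarrow> y \<in> K"
      unfolding J by metis
    then show "x + y \<in> J"
      unfolding J by (intro exI[of _ "F \<union> G"]) (simp add: lower_idealD(2))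
  next
    fix a x
    assume "x \<in> J"
    then show "a * x \<in> J"
      unfolding J by (meson lower_idealD(3))
  next
    fix x y
    assume "y \<in> J" "x + y = y"
    then show "x \<in> J"
      unfolding J by (meson lower_idealD(4))
  qed
  \<comment> \<open>A finite \<open>F\<close> witnessing \<open>1 \<in> J\<close> would put 1 into
    the proper \<open>K\<close> that the assumption provides for \<open>F\<close>.\<close>
  show "1 \<notin> J"
    unfolding J by (meson assms)
  show "S \<subseteq> J"
  proof
    fix x
    assume "x \<in> S"
    then show "x \<in> J"
      unfolding J by (intro exI[of _ "{x}"]) simp
  qed
qed

section \<open>Congruences with two classes\<close>

text \<open>For a prime lower ideal \<open>P\<close> this is the kernel of the homomorphism to the
  Boolean semiring {0, 1} that sends exactly \<open>P\<close> to 0.\<close>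

definition two_class :: "'a set \<Rightarrow> 'a rel" where
  "two_class P = {(x, y). x \<in> P \<longleftrightarrow> y \<in> P}"

lemma ideal_of_two_class:
  assumes "0 \<in> P"
  shows "ideal_of (two_class P) = P"
  using assms by (auto simp: two_class_def ideal_of_def)

lemma subset_two_class:
  assumes "congruence R"
  shows "R \<subseteq> two_class (ideal_of R)"
proof -
  have "(x, 0) \<in> R \<longleftrightarrow> (y, 0) \<in> R" if "(x, y) \<in> R" for x y
    using that congruenceD(2,3)[OF assms] by blast
  then show ?thesis
    by (auto simp: two_class_def ideal_of_def)
qed

text \<open>Membership in \<open>P\<close> turns products into disjunctions by primality and sums
  into conjunctions by downward closure, so both operations respect the two classes.\<close>

lemma nontrivial_congruence_two_class:
  assumes "prime_ideal P" "lower_ideal P"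
  shows "nontrivial_congruence (two_class P)"
proof -
  have mult: "x * y \<in> P \<longleftrightarrow> x \<in> P \<or> y \<in> P" for x y
    using assms(1) lower_idealD(3)[OF assms(2)]
    unfolding prime_ideal_def by (metis mult.commute)
  have "equiv UNIV (two_class P)"
    by (auto simp: two_class_def equiv_def refl_on_def sym_def trans_def)
  then have "congruence (two_class P)"
    by (auto simp: congruence_def two_class_def mult lower_ideal_add_iff[OF assms(2)])
  moreover have "two_class P \<noteq> UNIV"
    using assms(1) lower_idealD(1)[OF assms(2)]
    unfolding prime_ideal_def two_class_def by blast
  ultimately show ?thesis
    by (simp add: nontrivial_congruence_def)
qed

lemma one_notin_ideal_of:
  assumes "nontrivial_congruence R"
  shows "1 \<notin> ideal_of R"
proof
  assume "1 \<in> ideal_of R"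
  have R: "congruence R" "R \<noteq> UNIV"
    using assms by (auto simp: nontrivial_congruence_def)
  have "ideal_of R = UNIV"
    using lower_ideal_eq_UNIV_iff[OF lower_ideal_ideal_of[OF R(1)]] \<open>1 \<in> ideal_of R\<close> by simp
  then have "(x, y) \<in> R" for x y
    using congruenceD(2,3)[OF R(1)] unfolding ideal_of_def by blast
  then show False using R(2) by auto
qed

text \<open>A maximal congruence is prime, so the two-class relation of its zero class is a
  nontrivial congruence above it.\<close>

lemma MaxSpec_eq_two_class:
  assumes "R \<in> MaxSpec"
  shows "R = two_class (ideal_of R)"
proof -
  have R: "congruence R" "prime_congruence R"
    using assms MaxSpec_subset_Spec
    by (auto simp: Spec_def MaxSpec_def nontrivial_congruence_def)
  have "nontrivial_congruence (two_class (ideal_of R))"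
    using nontrivial_congruence_two_class prime_ideal_of_congruence lower_ideal_ideal_of R by blast
  then show ?thesis
    using assms subset_two_class[OF R(1)] unfolding MaxSpec_def by blast
qed

lemma two_class_mem_MaxSpec:
  assumes M: "lower_ideal M" "1 \<notin> M"
    and max: "\<And>K. lower_ideal K \<Longrightarrow> 1 \<notin> K \<Longrightarrow> M \<subseteq> K \<Longrightarrow> K = M"
  shows "two_class M \<in> MaxSpec"
proof -
  have "prime_ideal M" by (rule prime_ideal_maximal[OF assms])
  then have "nontrivial_congruence (two_class M)"
    using M(1) by (rule nontrivial_congruence_two_class)
  moreover have "R = two_class M" if R: "nontrivial_congruence R" "two_class M \<subseteq> R" for R
  proof -
    have c: "congruence R" using R(1) by (simp add: nontrivial_congruence_def)
    \<comment> \<open>The zero class of \<open>R\<close> is a proper lower ideal above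
      \<open>M\<close>, hence \<open>M\<close> itself; \<open>subset_two_class\<close> then bounds
      \<open>R\<close> from above.\<close>
    have "M \<subseteq> ideal_of R"
      using R(2) ideal_of_two_class[OF lower_idealD(1)[OF M(1)]] by (auto simp: ideal_of_def)
    then have "ideal_of R = M"
      by (intro max lower_ideal_ideal_of c one_notin_ideal_of R(1))
    then show ?thesis
      using subset_two_class[OF c] R(2) by auto
  qed
  ultimately show ?thesis
    unfolding MaxSpec_def by blast
qed

text \<open>Serves both spaces: finite sets need only lie in proper lower ideals, while the point
  found is a maximal congruence.\<close>

lemma MaxSpec_finite_character:
  assumes "\<And>F. finite F \<Longrightarrow> F \<subseteq> S \<Longrightarrow> \<exists>K. lower_ideal K \<and> 1 \<notin> K \<and> F \<subseteq> K"
  shows "\<exists>R\<in>MaxSpec. S \<subseteq> ideal_of R"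
proof -
  obtain J where J: "lower_ideal J" "1 \<notin> J" "S \<subseteq> J"
    by (rule lower_ideal_finite_character[OF assms])
  obtain M where M: "lower_ideal M" "1 \<notin> M" "J \<subseteq> M"
    "\<And>K. lower_ideal K \<Longrightarrow> 1 \<notin> K \<Longrightarrow> M \<subseteq> K \<Longrightarrow> K = M"
    using J(1,2) by (rule lower_ideal_subset_maximal) auto
  show ?thesis
  proof
    show "two_class M \<in> MaxSpec" using M(1,2,4) by (rule two_class_mem_MaxSpec)
    show "S \<subseteq> ideal_of (two_class M)"
      using J(3) M(1,3) ideal_of_two_class lower_idealD(1) by blast
  qed
qed

section \<open>Hull-kernel topologies\<close>

text \<open>The open sets given by sets \<open>g U\<close> cover \<open>X\<close> iff no
  \<open>f x\<close> contains the union of all \<open>g U\<close>. By \<open>fc\<close> some finite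
  \<open>F\<close> in that union already lies in no \<open>f x\<close>, and finitely many
  \<open>g U\<close> cover \<open>F\<close>.\<close>

lemma hull_kernel_compact_space:
  assumes op: "\<And>U. openin T U \<longleftrightarrow> (\<exists>S. U = X - {x \<in> X. S \<subseteq> f x})"
    and X: "topspace T = X"
    and fc: "\<And>S. (\<And>F. finite F \<Longrightarrow> F \<subseteq> S \<Longrightarrow> \<exists>x\<in>X. F \<subseteq> f x) \<Longrightarrow> \<exists>x\<in>X. S \<subseteq> f x"
  shows "compact_space T"
  unfolding compact_space_alt X
proof (intro allI impI)
  fix \<U>
  assume "(\<forall>U\<in>\<U>. openin T U) \<and> X \<subseteq> \<Union>\<U>"
  then have \<U>: "\<forall>U\<in>\<U>. openin T U" "X \<subseteq> \<Union>\<U>" by auto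
  then obtain g where "\<forall>U\<in>\<U>. U = X - {x \<in> X. g U \<subseteq> f x}"
    unfolding op by metis
  then have g: "x \<in> U \<longleftrightarrow> \<not> g U \<subseteq> f x" if "U \<in> \<U>" "x \<in> X" for U x
    using that by blast
  have "\<not> \<Union>(g ` \<U>) \<subseteq> f x" if x: "x \<in> X" for x
  proof -
    obtain U where "U \<in> \<U>" "x \<in> U" using x \<U>(2) by blast
    then have "\<not> g U \<subseteq> f x" using g x by blast
    then show ?thesis using \<open>U \<in> \<U>\<close> by blast
  qed
  then have "\<not> (\<exists>x\<in>X. \<Union>(g ` \<U>) \<subseteq> f x)" by blast
  then obtain F where F: "finite F" "F \<subseteq> \<Union>(g ` \<U>)" "\<And>x. x \<in> X \<Longrightarrow> \<not> F \<subseteq> f x"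
    using fc[of "\<Union>(g ` \<U>)"] by meson
  obtain \<H> where "finite \<H>" "\<H> \<subseteq> g ` \<U>" "F \<subseteq> \<Union>\<H>"
    using finite_subset_Union[OF F(1,2)] by metis
  then obtain \<V> where \<V>: "\<V> \<subseteq> \<U>" "finite \<V>" "F \<subseteq> \<Union>(g ` \<V>)"
    using finite_subset_image by metis
  have "X \<subseteq> \<Union>\<V>"
  proof
    fix x
    assume "x \<in> X"
    then obtain U where "U \<in> \<V>" "\<not> g U \<subseteq> f x"
      using F(3) \<V>(3) by blast
    then have "x \<in> U"
      using g \<V>(1) \<open>x \<in> X\<close> by blast
    then show "x \<in> \<Union>\<V>" using \<open>U \<in> \<V>\<close> by blast
  qed
  then show "\<exists>\<F>. finite \<F> \<and> \<F> \<subseteq> \<U> \<and> X \<subseteq> \<Union>\<F>"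
    using \<V>(1,2) by blast
qed

text \<open>An element \<open>a\<close> of exactly one of \<open>f x\<close> and \<open>f y\<close>
  separates them through the open set of \<open>{a}\<close>.\<close>

lemma hull_kernel_t0_space:
  assumes op: "\<And>U. openin T U \<longleftrightarrow> (\<exists>S. U = X - {x \<in> X. S \<subseteq> f x})"
    and X: "topspace T = X"
    and inj: "inj_on f X"
  shows "t0_space T"
  unfolding t0_space_def X
proof (intro ballI impI)
  fix x y
  assume xy: "x \<in> X" "y \<in> X" "x \<noteq> y"
  then obtain a where a: "a \<in> f x \<longleftrightarrow> a \<notin> f y"
    using inj unfolding inj_on_def by blast
  have "openin T (X - {z \<in> X. {a} \<subseteq> f z})"
    unfolding op by blast
  then show "\<exists>U. openin T U \<and> (x \<notin> U) = (y \<in> U)"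
    using a xy by (intro exI conjI) auto
qed

section \<open>The induced topologies on saturated primes and on maximal congruences\<close>

lemma openin_Pr_s_topology:
  "openin Pr_s_topology (U :: 'a::b1_algebra set set) \<longleftrightarrow> (\<exists>S. U = Pr_s - {P \<in> Pr_s. S \<subseteq> P})"
proof -
  have "Pr_s \<inter> (Pr - W S) = Pr_s - {P \<in> Pr_s. S \<subseteq> P}" for S :: "'a set"
    by (auto simp: Pr_s_def Pr_def W_def)
  then show ?thesis
    unfolding Pr_s_topology_def openin_subtopology_alt image_def openin_Pr_topology by auto
qed

lemma topspace_Pr_s_topology: "topspace Pr_s_topology = (Pr_s :: 'a::b1_algebra set set)"
  by (auto simp: Pr_s_topology_def topspace_Pr_topology Pr_s_def Pr_def)

lemma openin_MaxSpec_topology: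
  "openin MaxSpec_topology (U :: 'a::b1_algebra rel set)
    \<longleftrightarrow> (\<exists>S. U = MaxSpec - {R \<in> MaxSpec. S \<subseteq> ideal_of R})"
proof -
  have "MaxSpec \<inter> (Spec - V S) = MaxSpec - {R \<in> MaxSpec. S \<subseteq> ideal_of R}" for S :: "'a set"
    using MaxSpec_subset_Spec by (auto simp: V_def)
  then show ?thesis
    unfolding MaxSpec_topology_def openin_subtopology_alt image_def openin_Spec_topology by auto
qed

lemma topspace_MaxSpec_topology: "topspace MaxSpec_topology = (MaxSpec :: 'a::b1_algebra rel set)"
  using MaxSpec_subset_Spec by (auto simp: MaxSpec_topology_def topspace_Spec_topology)

lemma Pr_s_lower_ideal:
  assumes "P \<in> Pr_s"
  shows "lower_ideal P" "1 \<notin> P"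
proof -
  show "lower_ideal P"
    using assms lower_ideal_ideal_of by (auto simp: Pr_s_def saturated_def)
  then show "1 \<notin> P"
    using assms lower_ideal_eq_UNIV_iff by (auto simp: Pr_s_def prime_ideal_def)
qed

lemma MaxSpec_ideal_of_mem_Pr_s:
  assumes "R \<in> MaxSpec"
  shows "ideal_of R \<in> Pr_s"
proof -
  have "congruence R" "prime_congruence R"
    using assms MaxSpec_subset_Spec
    by (auto simp: Spec_def MaxSpec_def nontrivial_congruence_def)
  then show ?thesis
    using prime_ideal_of_congruence by (auto simp: Pr_s_def saturated_def prime_ideal_def)
qed

theorem theorem6p1:
  shows "t0_space (Pr_s_topology :: 'a::b1_algebra set topology)
    \<and> compact_space (Pr_s_topology :: 'a set topology)
    \<and> t0_space (MaxSpec_topology :: 'a rel topology)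
    \<and> compact_space (MaxSpec_topology :: 'a rel topology)"
proof (intro conjI)
  show "t0_space (Pr_s_topology :: 'a set topology)"
    by (rule hull_kernel_t0_space[OF openin_Pr_s_topology topspace_Pr_s_topology])
      (simp add: inj_on_def)
  \<comment> \<open>Here \<open>f\<close> is \<open>ideal_of\<close>, injective because
    \<open>two_class\<close> recovers a maximal congruence from its zero class.\<close>
  show "t0_space (MaxSpec_topology :: 'a rel topology)"
    by (rule hull_kernel_t0_space[OF openin_MaxSpec_topology topspace_MaxSpec_topology])
      (metis inj_onI MaxSpec_eq_two_class)
  show "compact_space (Pr_s_topology :: 'a set topology)"
  proof (rule hull_kernel_compact_space[OF openin_Pr_s_topology topspace_Pr_s_topology])
    fix S :: "'a set"
    assume "\<And>F. finite F \<Longrightarrow> F \<subseteq> S \<Longrightarrow> \<exists>P\<in>Pr_s. F \<subseteq> P"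
    \<comment> \<open>The required saturated prime is found as the zero class of a maximal
      congruence.\<close>
    then have "\<exists>R\<in>MaxSpec. S \<subseteq> ideal_of R"
      by (intro MaxSpec_finite_character) (meson Pr_s_lower_ideal)
    then show "\<exists>P\<in>Pr_s. S \<subseteq> P"
      using MaxSpec_ideal_of_mem_Pr_s by blast
  qed
  show "compact_space (MaxSpec_topology :: 'a rel topology)"
  proof (rule hull_kernel_compact_space[OF openin_MaxSpec_topology topspace_MaxSpec_topology])
    fix S :: "'a set"
    assume "\<And>F. finite F \<Longrightarrow> F \<subseteq> S \<Longrightarrow> \<exists>R\<in>MaxSpec. F \<subseteq> ideal_of R"
    then show "\<exists>R\<in>MaxSpec. S \<subseteq> ideal_of R"
      by (intro MaxSpec_finite_character) (meson MaxSpec_ideal_of_mem_Pr_s Pr_s_lower_ideal)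
  qed
qed

end
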